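(* Let $\mathcal{H}$ be a separable complex Hilbert space and let $\Psi=(\psi_n)_{n\in\Gamma}$ be a family of vectors in $\mathcal{H}$. Let $C\in GL(\mathcal{H})$ be self-adjoint and diagonal on $\Psi$, and assume that it generates a controlled frame, i.e. that $\Psi$ is a $C$-controlled frame. Then the sequence $(w_n)_{n\in\Gamma}$, which verifies the relations $C\psi_n = w_n\psi_n$ for all $n\in\Gamma$, is semi-normalized and positive. Furthermore $C = \mathbf{M}_{\mathbf{w},\widetilde\Psi,\Psi}$, that is, $$C f = \sum_{n\in\Gamma} w_n \langle f, \widetilde\psi_n\rangle\, \psi_n \qquad\text{for all } f\in\mathcal{H},$$ where $\mathbf{w}=(w_n)_{n\in\Gamma}$ and $\widetilde\Psi=(\widetilde\psi_n)_{n\in\Gamma}$ is the canonical dual frame of $\Psi$.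
   Context: The inner product $\langle\cdot,\cdot\rangle$ is linear in the first coordinate. $\Gamma$ is a countable index set. $GL(\mathcal{H})$ is the set of bounded linear operators on $\mathcal{H}$ with a bounded inverse. An operator $C$ is diagonal on $\Psi=(\psi_n)_{n\in\Gamma}$ if there are scalars $w_n$ with $C\psi_n=w_n\psi_n$ for all $n\in\Gamma$. For $C\in GL(\mathcal{H})$, a family $\Psi=(\psi_n)_{n\in\Gamma}$ in $\mathcal{H}$ is a $C$-controlled frame if there are constants $m_{CL}>0$, $M_{CL}<\infty$ such that $m_{CL}\|f\|^2 \le \sum_{n} \langle \psi_n, f\rangle\langle f, C\psi_n\rangle \le M_{CL}\|f\|^2$ for all $f\in\mathcal{H}$. Every $C$-controlled frame is a frame in the usual sense, i.e. there are $m>0$, $M<\infty$ with $m\|f\|^2 \le \sum_{n} |\langle f,\psi_n\rangle|^2 \le M\|f\|^2$ for all $f\in\mathcal{H}$. With the frame operator $L f=\sum_n\langle f,\psi_n\rangle\psi_n$ (which is bounded and invertible for a frame), the canonical dual frame is $\widetilde\Psi=(\widetilde\psi_n)=(L^{-1}\psi_n)$. For frames $\Psi=(\psi_n)$, $\Phi=(\phi_n)$ and a scalar sequence $\mathbf{m}=(m_n)$, the frame multiplier is the operator $\mathbf{M}_{\mathbf{m},\Psi,\Phi} f=\sum_n m_n\langle f,\psi_n\rangle\phi_n$. A sequence $(c_n)$ is semi-normalized if there are constants $b\ge a>0$ with $a\le |c_n|\le b$ for all $n$. A sequence $(w_n)$ is positive if $w_n>0$ for all $n$.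
   Formalization: Semi-normalization and positivity of (w_n) are stated only for indices n with ψ_n ≠ 0, because where ψ_n = 0 the relation Cψ_n = w_nψ_n does not determine w_n; the formula for C is stated over all of Γ. *)

theory Defs
  imports "HOL-Analysis.Analysis"
begin

class scaleC =
  fixes scaleC :: "complex \<Rightarrow> 'a \<Rightarrow> 'a" (infixr "*\<^sub>C" 75)

text \<open>
  The real scalar multiplication, the norm and the topology are those of
  \<^class>\<open>real_normed_vector\<close>; the axioms make the scalar multiplications
  agree on the reals and the norm the one induced by the inner product, which is linear in the
  first coordinate. Positive definiteness is contained in \<open>cinner_self\<close>.
\<close>

class complex_inner = real_normed_vector + scaleC +
  fixes cinner :: "'a \<Rightarrow> 'a \<Rightarrow> complex"
  assumes scaleC_add_right: "a *\<^sub>C (x + y) = a *\<^sub>C x + a *\<^sub>C y"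
    and scaleC_add_left: "(a + b) *\<^sub>C x = a *\<^sub>C x + b *\<^sub>C x"
    and scaleC_scaleC: "a *\<^sub>C (b *\<^sub>C x) = (a * b) *\<^sub>C x"
    and scaleC_of_real: "complex_of_real r *\<^sub>C x = r *\<^sub>R x"
    and cinner_add_left: "cinner (x + y) z = cinner x z + cinner y z"
    and cinner_scaleC_left: "cinner (a *\<^sub>C x) y = a * cinner x y"
    and cinner_commute: "cinner y x = cnj (cinner x y)"
    and cinner_self: "cinner x x = complex_of_real ((norm x)\<^sup>2)"

class chilbert_space = complex_inner + complete_space

definition bounded_clinear :: "('a::complex_inner \<Rightarrow> 'b::complex_inner) \<Rightarrow> bool" where
  "bounded_clinear A \<longleftrightarrow> bounded_linear A \<and> (\<forall>c x. A (c *\<^sub>C x) = c *\<^sub>C A x)"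

definition GL :: "('a::complex_inner \<Rightarrow> 'a) set" where
  "GL = {A. bounded_clinear A \<and> (\<exists>B. bounded_clinear B \<and> A \<circ> B = id \<and> B \<circ> A = id)}"

definition self_adjoint :: "('a::complex_inner \<Rightarrow> 'a) \<Rightarrow> bool" where
  "self_adjoint A \<longleftrightarrow> (\<forall>f g. cinner (A f) g = cinner f (A g))"

definition diagonal_on ::
    "('a::complex_inner \<Rightarrow> 'a) \<Rightarrow> 'i set \<Rightarrow> ('i \<Rightarrow> 'a) \<Rightarrow> bool" where
  "diagonal_on C \<Gamma> \<psi> \<longleftrightarrow> (\<exists>w. \<forall>n\<in>\<Gamma>. C (\<psi> n) = w n *\<^sub>C \<psi> n)"

text \<open>
  The index set carries no order, so all series are unordered sums. The inequalities
  presuppose that the sum, a priori complex, is a real number \<open>s\<close>.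
\<close>

definition controlled_frame ::
    "('a::complex_inner \<Rightarrow> 'a) \<Rightarrow> 'i set \<Rightarrow> ('i \<Rightarrow> 'a) \<Rightarrow> bool" where
  "controlled_frame C \<Gamma> \<psi> \<longleftrightarrow>
     (\<exists>m>0. \<exists>M. \<forall>f. \<exists>s::real.
        ((\<lambda>n. cinner (\<psi> n) f * cinner f (C (\<psi> n))) has_sum complex_of_real s) \<Gamma> \<and>
        m * (norm f)\<^sup>2 \<le> s \<and> s \<le> M * (norm f)\<^sup>2)"

definition frame_operator :: "'i set \<Rightarrow> ('i \<Rightarrow> 'a::complex_inner) \<Rightarrow> 'a \<Rightarrow> 'a" where
  "frame_operator \<Gamma> \<psi> f = (\<Sum>\<^sub>\<infinity>n\<in>\<Gamma>. cinner f (\<psi> n) *\<^sub>C \<psi> n)"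

text \<open>
  The inverse below is the genuine one whenever \<open>\<psi>\<close> is a frame, since the frame operator is
  then bijective.
\<close>

definition canonical_dual :: "'i set \<Rightarrow> ('i \<Rightarrow> 'a::complex_inner) \<Rightarrow> 'i \<Rightarrow> 'a" where
  "canonical_dual \<Gamma> \<psi> n = inv (frame_operator \<Gamma> \<psi>) (\<psi> n)"

definition frame_multiplier ::
    "'i set \<Rightarrow> ('i \<Rightarrow> complex) \<Rightarrow> ('i \<Rightarrow> 'a::complex_inner) \<Rightarrow> ('i \<Rightarrow> 'a) \<Rightarrow> 'a \<Rightarrow> 'a" where
  "frame_multiplier \<Gamma> m \<psi> \<phi> f = (\<Sum>\<^sub>\<infinity>n\<in>\<Gamma>. (m n * cinner f (\<psi> n)) *\<^sub>C \<phi> n)"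

definition semi_normalized :: "'i set \<Rightarrow> ('i \<Rightarrow> complex) \<Rightarrow> bool" where
  "semi_normalized \<Gamma> c \<longleftrightarrow>
     (\<exists>a b. 0 < a \<and> a \<le> b \<and> (\<forall>n\<in>\<Gamma>. a \<le> cmod (c n) \<and> cmod (c n) \<le> b))"

definition positive_seq :: "'i set \<Rightarrow> ('i \<Rightarrow> complex) \<Rightarrow> bool" where
  "positive_seq \<Gamma> w \<longleftrightarrow> (\<forall>n\<in>\<Gamma>. w n \<in> \<real> \<and> 0 < Re (w n))"

end

theory Submission
  imports Defs
begin

text \<open>
  The nonzero vectors \<open>\<psi> n\<close> are eigenvectors of the self-adjoint operator \<open>C\<close>, so their weights
  \<open>w n\<close> are real. Boundedness of \<open>C\<close> and of its inverse keeps the moduli of these weights between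
  two positive constants. A zero vector contributes nothing to any of the series, whatever its
  weight.

  Positivity rests on the orthogonality of eigenvectors that belong to distinct eigenvalues: in
  the controlled series \<open>\<Sum>n. w n \<bar>\<langle>f, \<psi> n\<rangle>\<bar>\<^sup>2\<close> at \<open>f = \<psi> k\<close>, only indices with
  \<open>w n = w k\<close> contribute, so the series has the sign of \<open>w k\<close>, and the lower bound of the
  controlled frame makes it positive (\<open>controlled_weight_pos\<close>).

  Positive weights bounded above and below compare the controlled series with
  \<open>\<Sum>n. \<bar>\<langle>f, \<psi> n\<rangle>\<bar>\<^sup>2\<close>, so \<open>\<psi>\<close> is a frame (\<open>frame_of_weighted\<close>). Its frame operator \<open>L\<close> is then
  defined by an unconditionally convergent series, symmetric and bijective (\<open>frame_operator_bij\<close>).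
  Hence \<open>\<langle>f, L\<inverse> \<psi> n\<rangle> = \<langle>L\<inverse> f, \<psi> n\<rangle>\<close>, and the representation of \<open>C\<close> is obtained by applying
  \<open>C\<close> term by term to \<open>f = L (L\<inverse> f) = \<Sum>n. \<langle>L\<inverse> f, \<psi> n\<rangle> \<psi> n\<close>.
\<close>

section \<open>Complex inner product spaces\<close>

lemma cinner_add_right:
  "cinner (x::'a::complex_inner) (y + z) = cinner x y + cinner x z"
  by (metis cinner_add_left cinner_commute complex_cnj_add)

lemma cinner_scaleC_right:
  "cinner (x::'a::complex_inner) (c *\<^sub>C y) = cnj c * cinner x y"
  by (metis cinner_commute cinner_scaleC_left complex_cnj_mult)

lemma scaleC_zero_right [simp]: "c *\<^sub>C (0::'a::complex_inner) = 0"
  using scaleC_add_right[of c 0 "0::'a"] by simp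

lemma cinner_zero_right [simp]: "cinner (x::'a::complex_inner) 0 = 0"
  using cinner_add_right[of x 0 0] by simp

lemma cinner_zero_left [simp]: "cinner 0 (x::'a::complex_inner) = 0"
  using cinner_add_left[of 0 0 x] by simp

lemma cinner_diff_left:
  "cinner (x - y) (z::'a::complex_inner) = cinner x z - cinner y z"
  using cinner_add_left[of "x - y" y z] by simp

lemma cinner_diff_right:
  "cinner (z::'a::complex_inner) (x - y) = cinner z x - cinner z y"
  using cinner_add_right[of z "x - y" y] by simp

lemma cinner_scaleR_left: "cinner (r *\<^sub>R x) (y::'a::complex_inner) = of_real r * cinner x y"
  by (metis cinner_scaleC_left scaleC_of_real)

lemma cinner_scaleR_right: "cinner (x::'a::complex_inner) (r *\<^sub>R y) = of_real r * cinner x y"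
  by (metis cinner_scaleC_right scaleC_of_real complex_cnj_complex_of_real)

lemma cinner_mult_commute:
  "cinner (y::'a::complex_inner) x * cinner x y = complex_of_real ((cmod (cinner x y))\<^sup>2)"
  by (metis cinner_commute complex_norm_square mult.commute)

lemma cmod_cinner_commute: "cmod (cinner (y::'a::complex_inner) x) = cmod (cinner x y)"
  by (metis cinner_commute complex_mod_cnj)

lemma norm_scaleC: "norm (c *\<^sub>C (x::'a::complex_inner)) = cmod c * norm x"
proof -
  have "complex_of_real ((norm (c *\<^sub>C x))\<^sup>2) = (c * cnj c) * cinner x x"
    unfolding cinner_self[symmetric]
    by (simp add: cinner_scaleC_left cinner_scaleC_right)
  also have "\<dots> = complex_of_real ((cmod c * norm x)\<^sup>2)"
    by (simp add: complex_norm_square[symmetric] cinner_self power_mult_distrib)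
  finally have "(norm (c *\<^sub>C x))\<^sup>2 = (cmod c * norm x)\<^sup>2"
    using of_real_eq_iff by blast
  then show ?thesis
    by (simp add: power2_eq_iff_nonneg)
qed

text \<open>Expanding \<open>norm (x - c y)\<close> at the projection coefficient \<open>c = \<langle>x, y\<rangle> / \<langle>y, y\<rangle>\<close> leaves exactly
  the defect of the inequality.\<close>

lemma cmod_cinner_le: "cmod (cinner x y) \<le> norm (x::'a::complex_inner) * norm y"
proof (cases "y = 0")
  case False
  define c where "c = cinner x y / of_real ((norm y)\<^sup>2)"
  have n: "(norm y)\<^sup>2 > 0"
    using False by simp
  have "complex_of_real ((norm (x - c *\<^sub>C y))\<^sup>2) =
      cinner x x - cnj c * cinner x y - c * cinner y x + c * cnj c * cinner y y"
    unfolding cinner_self[symmetric]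
    by (simp add: cinner_diff_left cinner_diff_right cinner_scaleC_left
        cinner_scaleC_right algebra_simps)
  also have "c * cnj c * cinner y y = c * cinner y x"
    using False
    by (simp add: c_def cinner_self cinner_commute[where y = y and x = x] field_simps)
  also have "cinner x x - cnj c * cinner x y - c * cinner y x + c * cinner y x =
      cinner x x - cnj c * cinner x y"
    by simp
  also have "\<dots> = complex_of_real ((norm x)\<^sup>2 - (cmod (cinner x y))\<^sup>2 / (norm y)\<^sup>2)"
    by (simp add: c_def cinner_self cinner_mult_commute[unfolded of_real_power, symmetric]
        cinner_commute[where y = y and x = x])
  finally have "(norm (x - c *\<^sub>C y))\<^sup>2 = (norm x)\<^sup>2 - (cmod (cinner x y))\<^sup>2 / (norm y)\<^sup>2"
    using of_real_eq_iff by blast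
  then have "(cmod (cinner x y))\<^sup>2 / (norm y)\<^sup>2 \<le> (norm x)\<^sup>2"
    using zero_le_power2[of "norm (x - c *\<^sub>C y)"] by linarith
  then have "(cmod (cinner x y))\<^sup>2 \<le> (norm x * norm y)\<^sup>2"
    using n by (simp add: divide_le_eq power_mult_distrib)
  then show ?thesis
    by (rule power2_le_imp_le) simp
qed simp

lemma bounded_linear_cinner_left: "bounded_linear (\<lambda>x. cinner x (y::'a::complex_inner))"
  by (rule bounded_linear_intro[where K = "norm y"])
    (simp_all add: cinner_add_left cinner_scaleR_left scaleR_conv_of_real cmod_cinner_le)

lemma bounded_linear_cinner_right: "bounded_linear (\<lambda>x. cinner (y::'a::complex_inner) x)"
  by (rule bounded_linear_intro[where K = "norm y"])
    (simp_all add: cinner_add_right cinner_scaleR_right scaleR_conv_of_real cmod_cinner_le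
      mult.commute[of _ "norm y"])

lemma cinner_sum_left:
  "cinner (sum f F) (y::'a::complex_inner) = (\<Sum>n\<in>F. cinner (f n) y)"
  by (rule linear_sum[OF bounded_linear.linear[OF bounded_linear_cinner_left]])

lemma norm_diff_power2:
  "(norm (x - (y::'a::complex_inner)))\<^sup>2 = (norm x)\<^sup>2 - 2 * Re (cinner y x) + (norm y)\<^sup>2"
proof -
  have "complex_of_real ((norm (x - y))\<^sup>2) = cinner x x - cinner x y - cinner y x + cinner y y"
    unfolding cinner_self[symmetric]
    by (simp add: cinner_diff_left cinner_diff_right)
  then have "Re (complex_of_real ((norm (x - y))\<^sup>2)) =
      Re (cinner x x - cinner x y - cinner y x + cinner y y)"
    by (rule arg_cong)
  moreover have "Re (cinner x y) = Re (cinner y x)"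
    by (subst cinner_commute) simp
  ultimately show ?thesis
    by (simp add: cinner_self)
qed

section \<open>Unconditional convergence\<close>

text \<open>Over the tail \<open>F - F0\<close> of a finite set, the hypothesis makes the partial sums of \<open>f\<close> as small
  as those of \<open>g\<close>, which is the Cauchy criterion. Absolute convergence of \<open>f\<close> would be too much to
  ask: with \<open>g = (\<lambda>n. (norm (f n))\<^sup>2)\<close> an orthogonal series is only square-summable.\<close>

lemma summable_on_if_norm_power2_sum_le:
  fixes f :: "'i \<Rightarrow> 'a::{real_normed_vector, complete_space}" and g :: "'i \<Rightarrow> real"
  assumes g: "g summable_on A" and nonneg: "\<And>n. n \<in> A \<Longrightarrow> 0 \<le> g n"
    and le: "\<And>F. finite F \<Longrightarrow> F \<subseteq> A \<Longrightarrow> (norm (sum f F))\<^sup>2 \<le> K * sum g F"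
    and K: "0 < K"
  shows "f summable_on A"
proof -
  obtain S where S: "(g has_sum S) A"
    using g by (auto simp: summable_on_def)
  have "\<exists>P. eventually P (finite_subsets_at_top A) \<and>
      (\<forall>F1 F2. P F1 \<and> P F2 \<longrightarrow> dist (sum f F1) (sum f F2) < e)" if e: "e > 0" for e
  proof -
    define d where "d = (e / 2)\<^sup>2 / K"
    have d: "d > 0"
      using e K by (simp add: d_def)
    have "eventually (\<lambda>F. S - d < sum g F) (finite_subsets_at_top A)"
      using S d unfolding has_sum_def by (intro order_tendstoD(1)) auto
    then obtain F0 where F0: "finite F0" "F0 \<subseteq> A" "S - d < sum g F0"
      by (auto simp: eventually_finite_subsets_at_top)
    define P where "P F \<longleftrightarrow> finite F \<and> F0 \<subseteq> F \<and> F \<subseteq> A" for F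
    have near: "dist (sum f F) (sum f F0) < e / 2" if "P F" for F
    proof -
      have F: "finite F" "F0 \<subseteq> F" "F \<subseteq> A"
        using that by (auto simp: P_def)
      have "(dist (sum f F) (sum f F0))\<^sup>2 = (norm (sum f (F - F0)))\<^sup>2"
        using F by (simp add: dist_norm sum_diff)
      also have "\<dots> \<le> K * sum g (F - F0)"
        using F by (intro le) auto
      also have "\<dots> = K * (sum g F - sum g F0)"
        using F by (simp add: sum_diff)
      also have "\<dots> \<le> K * (S - sum g F0)"
        using finite_sum_le_has_sum[OF S F(1,3)] nonneg K by (intro mult_left_mono) auto
      also have "\<dots> < K * d"
        using F0 K by simp
      also have "\<dots> = (e / 2)\<^sup>2"
        using K by (simp add: d_def)
      finally show ?thesis
        by (rule power2_less_imp_less) (use e in simp)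
    qed
    have "dist (sum f F1) (sum f F2) < e" if "P F1" "P F2" for F1 F2
      using near[OF that(1)] near[OF that(2)] dist_triangle2[of "sum f F1" "sum f F2" "sum f F0"]
      by linarith
    moreover have "eventually P (finite_subsets_at_top A)"
      unfolding P_def using F0 by (auto simp: eventually_finite_subsets_at_top)
    ultimately show ?thesis
      by blast
  qed
  then have "cauchy_filter (filtermap (sum f) (finite_subsets_at_top A))"
    by (simp add: cauchy_filter_metric_filtermap)
  moreover have "complete (UNIV::'a set)"
    by (rule complete_UNIV)
  ultimately obtain l where "(sum f \<longlongrightarrow> l) (finite_subsets_at_top A)"
    using complete_uniform[where S = "UNIV :: 'a set"] by (force simp add: filterlim_def)
  then show ?thesis
    by (auto simp: summable_on_def has_sum_def)
qed

section \<open>Frames and the frame operator\<close>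

text \<open>The condition \<open>A \<le> B\<close> keeps \<open>B\<close> positive even on the zero space, where the two estimates
  hold for every \<open>B\<close>.\<close>

definition frame_bounds :: "real \<Rightarrow> real \<Rightarrow> 'i set \<Rightarrow> ('i \<Rightarrow> 'a::complex_inner) \<Rightarrow> bool" where
  "frame_bounds A B \<Gamma> \<psi> \<longleftrightarrow> 0 < A \<and> A \<le> B \<and>
     (\<forall>f. (\<lambda>n. (cmod (cinner f (\<psi> n)))\<^sup>2) summable_on \<Gamma> \<and>
        A * (norm f)\<^sup>2 \<le> (\<Sum>\<^sub>\<infinity>n\<in>\<Gamma>. (cmod (cinner f (\<psi> n)))\<^sup>2) \<and>
        (\<Sum>\<^sub>\<infinity>n\<in>\<Gamma>. (cmod (cinner f (\<psi> n)))\<^sup>2) \<le> B * (norm f)\<^sup>2)"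

text \<open>The synthesis map is the adjoint of the analysis map, so it inherits its bound: with
  \<open>v = \<Sum>n\<in>F. c n *\<^sub>C \<psi> n\<close>, the Cauchy--Schwarz inequality for sums estimates
  \<open>\<langle>v, v\<rangle> = \<Sum>n\<in>F. c n * \<langle>\<psi> n, v\<rangle>\<close>.\<close>

lemma frame_synthesis_bound:
  assumes fr: "frame_bounds A B \<Gamma> \<psi>" and F: "finite F" "F \<subseteq> \<Gamma>"
  shows "(norm (\<Sum>n\<in>F. c n *\<^sub>C \<psi> n))\<^sup>2 \<le> B * (\<Sum>n\<in>F. (cmod (c n))\<^sup>2)"
proof -
  define v where "v = (\<Sum>n\<in>F. c n *\<^sub>C \<psi> n)"
  define S where "S = (\<Sum>n\<in>F. (cmod (c n))\<^sup>2)"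
  have B: "0 \<le> B"
    using fr by (simp add: frame_bounds_def)
  have "(\<Sum>n\<in>F. (cmod (cinner v (\<psi> n)))\<^sup>2) \<le> (\<Sum>\<^sub>\<infinity>n\<in>\<Gamma>. (cmod (cinner v (\<psi> n)))\<^sup>2)"
    using fr F by (intro finite_sum_le_infsum) (auto simp: frame_bounds_def)
  also have "\<dots> \<le> B * (norm v)\<^sup>2"
    using fr by (simp add: frame_bounds_def)
  finally have bessel: "(\<Sum>n\<in>F. (cmod (cinner v (\<psi> n)))\<^sup>2) \<le> B * (norm v)\<^sup>2" .
  have "complex_of_real ((norm v)\<^sup>2) = (\<Sum>n\<in>F. c n * cinner (\<psi> n) v)"
    by (subst cinner_self[symmetric], subst (1) v_def) (simp add: cinner_sum_left cinner_scaleC_left)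
  then have "(norm v)\<^sup>2 = cmod (\<Sum>n\<in>F. c n * cinner (\<psi> n) v)"
    by (metis norm_of_real abs_of_nonneg zero_le_power2)
  also have "\<dots> \<le> (\<Sum>n\<in>F. \<bar>cmod (c n)\<bar> * \<bar>cmod (cinner v (\<psi> n))\<bar>)"
    by (rule order_trans[OF norm_sum]) (simp add: norm_mult cmod_cinner_commute)
  also have "\<dots> \<le> L2_set (\<lambda>n. cmod (c n)) F * L2_set (\<lambda>n. cmod (cinner v (\<psi> n))) F"
    by (rule L2_set_mult_ineq)
  also have "\<dots> \<le> sqrt S * (sqrt B * norm v)"
    using bessel unfolding L2_set_def S_def
    by (intro mult_left_mono) (auto simp: sum_nonneg dest: real_sqrt_le_mono simp: real_sqrt_mult)
  finally have "norm v * norm v \<le> (sqrt S * sqrt B) * norm v"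
    by (simp add: power2_eq_square algebra_simps)
  then have "norm v \<le> sqrt S * sqrt B"
    using B by (cases "v = 0") (auto simp: S_def sum_nonneg)
  then have "(norm v)\<^sup>2 \<le> (sqrt S * sqrt B)\<^sup>2"
    by (intro power_mono) auto
  then show ?thesis
    using B by (simp add: power_mult_distrib v_def S_def sum_nonneg mult.commute)
qed

lemma frame_operator_has_sum:
  fixes \<psi> :: "'i \<Rightarrow> 'a::chilbert_space"
  assumes fr: "frame_bounds A B \<Gamma> \<psi>"
  shows "((\<lambda>n. cinner f (\<psi> n) *\<^sub>C \<psi> n) has_sum frame_operator \<Gamma> \<psi> f) \<Gamma>"
proof -
  have "(\<lambda>n. cinner f (\<psi> n) *\<^sub>C \<psi> n) summable_on \<Gamma>"
  proof (rule summable_on_if_norm_power2_sum_le)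
    show "(\<lambda>n. (cmod (cinner f (\<psi> n)))\<^sup>2) summable_on \<Gamma>"
      using fr unfolding frame_bounds_def by blast
    show "0 < B"
      using fr unfolding frame_bounds_def by linarith
  qed (use frame_synthesis_bound[OF fr] in simp_all)
  then show ?thesis
    by (simp add: frame_operator_def)
qed

lemma frame_operator_norm_le:
  fixes \<psi> :: "'i \<Rightarrow> 'a::chilbert_space"
  assumes fr: "frame_bounds A B \<Gamma> \<psi>"
  shows "norm (frame_operator \<Gamma> \<psi> f) \<le> B * norm f"
proof -
  have B: "0 \<le> B"
    using fr by (simp add: frame_bounds_def)
  define q where "q n = (cmod (cinner f (\<psi> n)))\<^sup>2" for n
  have q: "q summable_on \<Gamma>" "infsum q \<Gamma> \<le> B * (norm f)\<^sup>2"
    using fr unfolding q_def frame_bounds_def by blast+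
  have "((\<lambda>F. (norm (\<Sum>n\<in>F. cinner f (\<psi> n) *\<^sub>C \<psi> n))\<^sup>2) \<longlongrightarrow> (norm (frame_operator \<Gamma> \<psi> f))\<^sup>2)
      (finite_subsets_at_top \<Gamma>)"
    using frame_operator_has_sum[OF fr] unfolding has_sum_def by (intro tendsto_intros)
  moreover have "(norm (\<Sum>n\<in>F. cinner f (\<psi> n) *\<^sub>C \<psi> n))\<^sup>2 \<le> (B * norm f)\<^sup>2"
    if F: "finite F" "F \<subseteq> \<Gamma>" for F
  proof -
    have "(norm (\<Sum>n\<in>F. cinner f (\<psi> n) *\<^sub>C \<psi> n))\<^sup>2 \<le> B * sum q F"
      unfolding q_def by (rule frame_synthesis_bound[OF fr F])
    also have "\<dots> \<le> B * (B * (norm f)\<^sup>2)"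
      using finite_sum_le_infsum[OF q(1) F] q(2) B by (intro mult_left_mono) (auto simp: q_def)
    finally show ?thesis
      by (simp add: power2_eq_square algebra_simps)
  qed
  ultimately have "(norm (frame_operator \<Gamma> \<psi> f))\<^sup>2 \<le> (B * norm f)\<^sup>2"
    by (rule tendsto_upperbound[OF _ eventually_finite_subsets_at_top_weakI]) simp_all
  then show ?thesis
    by (rule power2_le_imp_le) (use B in simp)
qed

lemma frame_operator_diff:
  fixes \<psi> :: "'i \<Rightarrow> 'a::chilbert_space"
  assumes fr: "frame_bounds A B \<Gamma> \<psi>"
  shows "frame_operator \<Gamma> \<psi> (f - g) = frame_operator \<Gamma> \<psi> f - frame_operator \<Gamma> \<psi> g"
proof -
  have split: "cinner f (\<psi> n) *\<^sub>C \<psi> n =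
      cinner (f - g) (\<psi> n) *\<^sub>C \<psi> n + cinner g (\<psi> n) *\<^sub>C \<psi> n" for n
    by (simp add: cinner_diff_left scaleC_add_left[symmetric])
  have "((\<lambda>n. cinner f (\<psi> n) *\<^sub>C \<psi> n) has_sum
      (frame_operator \<Gamma> \<psi> (f - g) + frame_operator \<Gamma> \<psi> g)) \<Gamma>"
    unfolding split by (intro has_sum_add frame_operator_has_sum[OF fr])
  then have "frame_operator \<Gamma> \<psi> f = frame_operator \<Gamma> \<psi> (f - g) + frame_operator \<Gamma> \<psi> g"
    using frame_operator_has_sum[OF fr] has_sum_unique by blast
  then show ?thesis
    by simp
qed

lemma frame_operator_symmetric:
  fixes \<psi> :: "'i \<Rightarrow> 'a::chilbert_space"
  assumes fr: "frame_bounds A B \<Gamma> \<psi>"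
  shows "cinner (frame_operator \<Gamma> \<psi> f) g = cinner f (frame_operator \<Gamma> \<psi> g)"
proof -
  have "((\<lambda>n. cinner (cinner f (\<psi> n) *\<^sub>C \<psi> n) g) has_sum cinner (frame_operator \<Gamma> \<psi> f) g) \<Gamma>"
    by (intro has_sum_bounded_linear[OF bounded_linear_cinner_left] frame_operator_has_sum[OF fr])
  moreover have "((\<lambda>n. cinner f (cinner g (\<psi> n) *\<^sub>C \<psi> n)) has_sum
      cinner f (frame_operator \<Gamma> \<psi> g)) \<Gamma>"
    by (intro has_sum_bounded_linear[OF bounded_linear_cinner_right] frame_operator_has_sum[OF fr])
  moreover have "cinner (cinner f (\<psi> n) *\<^sub>C \<psi> n) g = cinner f (cinner g (\<psi> n) *\<^sub>C \<psi> n)" for n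
    by (simp add: cinner_scaleC_left cinner_scaleC_right
        cinner_commute[where y = "\<psi> n" and x = g])
  ultimately show ?thesis
    by (simp add: has_sum_unique)
qed

lemma frame_operator_quadratic_form_ge:
  fixes \<psi> :: "'i \<Rightarrow> 'a::chilbert_space"
  assumes fr: "frame_bounds A B \<Gamma> \<psi>"
  shows "A * (norm f)\<^sup>2 \<le> Re (cinner (frame_operator \<Gamma> \<psi> f) f)"
proof -
  have "((\<lambda>n. Re (cinner (cinner f (\<psi> n) *\<^sub>C \<psi> n) f)) has_sum
      Re (cinner (frame_operator \<Gamma> \<psi> f) f)) \<Gamma>"
    by (intro has_sum_Re has_sum_bounded_linear[OF bounded_linear_cinner_left]
        frame_operator_has_sum[OF fr])
  moreover have "Re (cinner (cinner f (\<psi> n) *\<^sub>C \<psi> n) f) = (cmod (cinner f (\<psi> n)))\<^sup>2" for n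
    by (metis Re_complex_of_real cinner_scaleC_left cinner_mult_commute mult.commute)
  ultimately have "(\<Sum>\<^sub>\<infinity>n\<in>\<Gamma>. (cmod (cinner f (\<psi> n)))\<^sup>2) = Re (cinner (frame_operator \<Gamma> \<psi> f) f)"
    by (simp add: infsumI)
  then show ?thesis
    using fr by (metis frame_bounds_def)
qed

text \<open>A Lax--Milgram argument: for small \<open>t > 0\<close> the map \<open>f \<mapsto> f - t (L f - g)\<close> is a contraction,
  because \<open>norm (h - t L h)\<^sup>2 = norm h\<^sup>2 - 2 t \<langle>L h, h\<rangle> + t\<^sup>2 norm (L h)\<^sup>2\<close> is at most
  \<open>(1 - 2 t A + t\<^sup>2 B\<^sup>2) norm h\<^sup>2\<close>; a fixed point solves \<open>L f = g\<close>, and it is the only solution.\<close>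

lemma frame_operator_bij:
  fixes \<psi> :: "'i \<Rightarrow> 'a::chilbert_space"
  assumes fr: "frame_bounds A B \<Gamma> \<psi>"
  shows "bij (frame_operator \<Gamma> \<psi>)"
proof -
  define L where "L = frame_operator \<Gamma> \<psi>"
  have A: "0 < A" and AB: "A \<le> B"
    using fr by (auto simp: frame_bounds_def)
  then have B: "0 < B"
    by simp
  \<comment> \<open>\<open>t = A / B\<^sup>2\<close> minimises \<open>1 - 2 t A + t\<^sup>2 B\<^sup>2\<close>.\<close>
  define t where "t = A / B\<^sup>2"
  define q where "q = 1 - (A / B)\<^sup>2"
  have t: "t > 0"
    using A B by (simp add: t_def)
  have q: "0 \<le> q" "q < 1"
    using A AB by (auto simp: q_def power_le_one)
  have "\<exists>!f. L f = g" for g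
  proof -
    define T where "T f = f - t *\<^sub>R (L f - g)" for f
    have "dist (T x) (T y) \<le> sqrt q * dist x y" for x y
    proof -
      define h where "h = x - y"
      have "T x - T y = h - t *\<^sub>R L h"
        by (simp add: T_def h_def L_def frame_operator_diff[OF fr] algebra_simps)
      then have "(dist (T x) (T y))\<^sup>2 =
          (norm h)\<^sup>2 - 2 * (t * Re (cinner (L h) h)) + t\<^sup>2 * (norm (L h))\<^sup>2"
        by (simp add: dist_norm norm_diff_power2 cinner_scaleR_left power_mult_distrib)
      also have "\<dots> \<le> (norm h)\<^sup>2 - 2 * (t * (A * (norm h)\<^sup>2)) + t\<^sup>2 * (B * norm h)\<^sup>2"
        using frame_operator_quadratic_form_ge[OF fr, of h] frame_operator_norm_le[OF fr, of h] t
        unfolding L_def by (intro add_mono diff_mono mult_left_mono power_mono) auto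
      also have "\<dots> = q * (norm h)\<^sup>2"
        using B by (simp add: q_def t_def field_simps power2_eq_square)
      also have "\<dots> = (sqrt q * dist x y)\<^sup>2"
        using q by (simp add: h_def dist_norm power_mult_distrib)
      finally show ?thesis
        by (rule power2_le_imp_le) (use q in simp)
    qed
    then have "\<exists>!f. T f = f"
      using q by (intro banach_fix_type[of "sqrt q"]) auto
    moreover have "T f = f \<longleftrightarrow> L f = g" for f
      using t by (auto simp: T_def)
    ultimately show ?thesis
      by simp
  qed
  then show ?thesis
    unfolding L_def[symmetric] bij_iff by blast
qed

lemma cinner_canonical_dual:
  fixes \<psi> :: "'i \<Rightarrow> 'a::chilbert_space"
  assumes fr: "frame_bounds A B \<Gamma> \<psi>"
  shows "cinner f (canonical_dual \<Gamma> \<psi> n) = cinner (inv (frame_operator \<Gamma> \<psi>) f) (\<psi> n)"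
proof -
  have surj: "surj (frame_operator \<Gamma> \<psi>)"
    using frame_operator_bij[OF fr] by (rule bij_is_surj)
  show ?thesis
    using frame_operator_symmetric[OF fr, of "inv (frame_operator \<Gamma> \<psi>) f" "canonical_dual \<Gamma> \<psi> n"]
    by (simp add: canonical_dual_def surj_f_inv_f[OF surj])
qed

section \<open>Eigenvalues of operators diagonal on a family\<close>

lemma self_adjoint_eigenvalue_real:
  assumes "self_adjoint C" "C x = c *\<^sub>C x" "x \<noteq> 0"
  shows "c \<in> \<real>"
proof -
  have "cinner (C x) x = cinner x (C x)"
    using assms(1) by (simp add: self_adjoint_def)
  then have "c = cnj c"
    using assms by (simp add: cinner_scaleC_left cinner_scaleC_right cinner_self)
  then show ?thesis
    by (metis Reals_cnj_iff)
qed

lemma self_adjoint_eigenvectors_orthogonal: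
  assumes "self_adjoint C" "C x = c *\<^sub>C x" "C y = d *\<^sub>C y" "d \<in> \<real>" "c \<noteq> d"
  shows "cinner x y = 0"
proof -
  have "cinner (C x) y = cinner x (C y)"
    using assms(1) by (simp add: self_adjoint_def)
  then have "c * cinner x y = d * cinner x y"
    using assms by (simp add: cinner_scaleC_left cinner_scaleC_right Reals_cnj_iff)
  then show ?thesis
    using assms by simp
qed

text \<open>The lower bound comes from the bounded inverse, as \<open>c\<inverse>\<close> is an eigenvalue of it.\<close>

lemma GL_eigenvalue_bounds:
  assumes "C \<in> GL"
  obtains a b where "0 < a" "a \<le> b"
    "\<And>c x. C x = c *\<^sub>C x \<Longrightarrow> x \<noteq> 0 \<Longrightarrow> a \<le> cmod c \<and> cmod c \<le> b"
proof -
  obtain D where "bounded_linear C" "bounded_linear D" and inv: "D \<circ> C = id"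
    using assms by (auto simp: GL_def bounded_clinear_def)
  then obtain K J where K: "0 < K" "\<And>x. norm (C x) \<le> norm x * K"
    and J: "0 < J" "\<And>x. norm (D x) \<le> norm x * J"
    by (metis bounded_linear.pos_bounded)
  have bounds: "1 / J \<le> cmod c \<and> cmod c \<le> K" if "C x = c *\<^sub>C x" "x \<noteq> 0" for c x
  proof -
    have nC: "norm (C x) = cmod c * norm x"
      using that by (simp add: norm_scaleC)
    have "D (C x) = x"
      using inv by (metis comp_apply id_apply)
    then have "norm x * 1 \<le> norm x * (cmod c * J)"
      using J(2)[of "C x"] nC by (simp add: algebra_simps)
    then have "1 \<le> cmod c * J"
      using that by (simp del: mult_1_right)
    moreover have "cmod c \<le> K"
      using K(2)[of x] nC that by (simp add: mult.commute)
    ultimately show ?thesis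
      using J by (simp add: divide_le_eq)
  qed
  \<comment> \<open>The maximum ensures \<open>a \<le> b\<close> even when \<open>C\<close> has no eigenvectors.\<close>
  show ?thesis
    by (rule that[of "1 / J" "max K (1 / J)"]) (use J bounds in \<open>auto simp: le_max_iff_disj\<close>)
qed

section \<open>Controlled frames generated by diagonal operators\<close>

text \<open>The controlled series at \<open>f = \<psi> k\<close> has all its nonzero terms at indices with
  \<open>w n = w k\<close>, so it could not be positive if \<open>w k \<le> 0\<close>.\<close>

lemma controlled_weight_pos:
  fixes C :: "'a::complex_inner \<Rightarrow> 'a"
  assumes sa: "self_adjoint C"
    and eig: "\<forall>n\<in>\<Gamma>. C (\<psi> n) = w n *\<^sub>C \<psi> n"
    and m: "0 < m"
    and sum: "((\<lambda>n. Re (w n) * (cmod (cinner (\<psi> k) (\<psi> n)))\<^sup>2) has_sum s) \<Gamma>"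
    and lower: "m * (norm (\<psi> k))\<^sup>2 \<le> s"
    and k: "k \<in> \<Gamma>" "\<psi> k \<noteq> 0"
  shows "0 < Re (w k)"
proof (rule ccontr)
  assume "\<not> 0 < Re (w k)"
  then have neg: "Re (w k) \<le> 0"
    by simp
  have nonpos: "Re (w n) * (cmod (cinner (\<psi> k) (\<psi> n)))\<^sup>2 \<le> 0" if n: "n \<in> \<Gamma>" for n
  proof (cases "cinner (\<psi> k) (\<psi> n) = 0")
    case False
    then have "\<psi> n \<noteq> 0"
      by auto
    then have "w n \<in> \<real>"
      using self_adjoint_eigenvalue_real[OF sa] eig n by blast
    then have "w k = w n"
      using self_adjoint_eigenvectors_orthogonal[OF sa] eig n k False by blast
    then show ?thesis
      using neg by (auto intro: mult_nonpos_nonneg)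
  qed simp
  have "s \<le> 0"
    by (rule has_sum_mono[OF sum has_sum_0[of _ "\<lambda>_. 0"]]) (use nonpos in auto)
  moreover have "0 < m * (norm (\<psi> k))\<^sup>2"
    using m k by simp
  ultimately show False
    using lower by simp
qed

lemma frame_of_weighted:
  fixes u :: "'i \<Rightarrow> real" and \<psi> :: "'i \<Rightarrow> 'a::complex_inner"
  assumes a: "0 < a" and u: "\<And>n. n \<in> \<Gamma> \<Longrightarrow> \<psi> n \<noteq> 0 \<Longrightarrow> a \<le> u n \<and> u n \<le> b"
    and b: "0 < b" and m: "0 < m"
    and s: "\<And>f. ((\<lambda>n. u n * (cmod (cinner f (\<psi> n)))\<^sup>2) has_sum s f) \<Gamma>"
    and lower: "\<And>f. m * (norm f)\<^sup>2 \<le> s f" and upper: "\<And>f. s f \<le> M * (norm f)\<^sup>2"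
  shows "frame_bounds (m / b) (max (m / b) (M / a)) \<Gamma> \<psi>"
proof -
  define q where "q f n = (cmod (cinner f (\<psi> n)))\<^sup>2" for f n
  have s': "((\<lambda>n. u n * q f n) has_sum s f) \<Gamma>" for f
    using s by (simp add: q_def)
  have le: "a * q f n \<le> u n * q f n" "u n * q f n \<le> b * q f n" if "n \<in> \<Gamma>" for f n
    using u[OF that] by (cases "\<psi> n = 0"; simp add: q_def mult_right_mono)+
  have sm: "q f summable_on \<Gamma>" for f
  proof -
    have "(\<lambda>n. a * q f n) summable_on \<Gamma>"
      by (rule summable_on_comparison_test[of "\<lambda>n. u n * q f n"])
        (use s' le a in \<open>auto simp: summable_on_def q_def\<close>)
    then show ?thesis
      using a by (simp add: summable_on_cmult_right')
  qed
  have "a * infsum (q f) \<Gamma> \<le> s f" "s f \<le> b * infsum (q f) \<Gamma>" for f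
    using le by (auto intro!: has_sum_mono[OF has_sum_cmult_right[OF has_sum_infsum[OF sm]] s']
        has_sum_mono[OF s' has_sum_cmult_right[OF has_sum_infsum[OF sm]]])
  then have bounds: "m / b * (norm f)\<^sup>2 \<le> infsum (q f) \<Gamma>" "infsum (q f) \<Gamma> \<le> M / a * (norm f)\<^sup>2"
    for f
    using lower[of f] upper[of f] a b order_trans
    by (fastforce simp: field_simps)+
  have "infsum (q f) \<Gamma> \<le> max (m / b) (M / a) * (norm f)\<^sup>2" for f
    by (rule order_trans[OF bounds(2) mult_right_mono]) simp_all
  then show ?thesis
    using bounds(1) sm m b unfolding frame_bounds_def q_def by auto
qed

(* Indices with \<psi> n = 0 are left out of the first two claims: there C (\<psi> n) = w n *\<^sub>C \<psi> n
   holds for every scalar w n. If no \<psi> n vanishes, the restricted index set is \<Gamma> itself. *)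

theorem proposition4p2:
  fixes C :: "'a::chilbert_space \<Rightarrow> 'a" and \<Gamma> :: "'i set" and \<psi> :: "'i \<Rightarrow> 'a"
  assumes "separable_space (euclidean :: 'a topology)"
    and "countable \<Gamma>"
    and "C \<in> GL"
    and "self_adjoint C"
    and "diagonal_on C \<Gamma> \<psi>"
    and "controlled_frame C \<Gamma> \<psi>"
  shows "\<forall>w. (\<forall>n\<in>\<Gamma>. C (\<psi> n) = w n *\<^sub>C \<psi> n) \<longrightarrow>
           semi_normalized {n\<in>\<Gamma>. \<psi> n \<noteq> 0} w \<and>
           positive_seq {n\<in>\<Gamma>. \<psi> n \<noteq> 0} w \<and>
           C = frame_multiplier \<Gamma> w (canonical_dual \<Gamma> \<psi>) \<psi> \<and>
           (\<forall>f. ((\<lambda>n. (w n * cinner f (canonical_dual \<Gamma> \<psi> n)) *\<^sub>C \<psi> n) has_sum C f) \<Gamma>)"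
proof (intro allI impI)
  fix w assume eig: "\<forall>n\<in>\<Gamma>. C (\<psi> n) = w n *\<^sub>C \<psi> n"
  have C: "bounded_linear C" "\<And>c x. C (c *\<^sub>C x) = c *\<^sub>C C x"
    using assms(3) by (auto simp: GL_def bounded_clinear_def)
  obtain a b where ab: "0 < a" "a \<le> b"
    and w_bounds: "\<And>c x. C x = c *\<^sub>C x \<Longrightarrow> x \<noteq> 0 \<Longrightarrow> a \<le> cmod c \<and> cmod c \<le> b"
    using GL_eigenvalue_bounds[OF assms(3)] by blast
  have semi: "semi_normalized {n\<in>\<Gamma>. \<psi> n \<noteq> 0} w"
    unfolding semi_normalized_def using ab w_bounds eig by blast
  have w_real: "w n \<in> \<real>" if "n \<in> \<Gamma>" "\<psi> n \<noteq> 0" for n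
    using self_adjoint_eigenvalue_real[OF assms(4)] eig that by blast
  obtain m M where m: "0 < m" and "\<forall>f. \<exists>s.
      ((\<lambda>n. cinner (\<psi> n) f * cinner f (C (\<psi> n))) has_sum complex_of_real s) \<Gamma> \<and>
      m * (norm f)\<^sup>2 \<le> s \<and> s \<le> M * (norm f)\<^sup>2"
    using assms(6) unfolding controlled_frame_def by blast
  then obtain s
    where ctrl: "\<And>f. ((\<lambda>n. cinner (\<psi> n) f * cinner f (C (\<psi> n))) has_sum complex_of_real (s f)) \<Gamma>"
      and lower: "\<And>f. m * (norm f)\<^sup>2 \<le> s f" and upper: "\<And>f. s f \<le> M * (norm f)\<^sup>2"
    using choice[OF \<open>\<forall>f. \<exists>s. _ f s\<close>] by blast
  have weighted: "((\<lambda>n. Re (w n) * (cmod (cinner f (\<psi> n)))\<^sup>2) has_sum s f) \<Gamma>" for f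
  proof -
    have "cinner (\<psi> n) f * cinner f (C (\<psi> n)) =
        complex_of_real (Re (w n) * (cmod (cinner f (\<psi> n)))\<^sup>2)" if n: "n \<in> \<Gamma>" for n
    proof (cases "\<psi> n = 0")
      case False
      then have "cnj (w n) = complex_of_real (Re (w n))"
        using w_real[OF n] by (metis Reals_cnj_iff of_real_Re)
      then show ?thesis
        using eig n by (simp add: cinner_scaleC_right cinner_mult_commute[unfolded of_real_power])
    qed simp
    then have "((\<lambda>n. complex_of_real (Re (w n) * (cmod (cinner f (\<psi> n)))\<^sup>2)) has_sum
        complex_of_real (s f)) \<Gamma>"
      using ctrl[of f] by (simp cong: has_sum_cong)
    then show ?thesis
      by (simp only: has_sum_of_real_iff)
  qed
  have pos: "0 < Re (w n)" if "n \<in> \<Gamma>" "\<psi> n \<noteq> 0" for n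
    using controlled_weight_pos[OF assms(4) eig m weighted lower that] .
  then have "positive_seq {n\<in>\<Gamma>. \<psi> n \<noteq> 0} w"
    using w_real by (auto simp: positive_seq_def)
  moreover have "a \<le> Re (w n) \<and> Re (w n) \<le> b" if "n \<in> \<Gamma>" "\<psi> n \<noteq> 0" for n
  proof -
    have "cmod (w n) = Re (w n)"
      using pos[OF that] w_real[OF that] by (metis norm_of_real of_real_Re abs_of_pos)
    then show ?thesis
      using w_bounds eig that by metis
  qed
  then obtain A B where fr: "frame_bounds A B \<Gamma> \<psi>"
    using frame_of_weighted[OF ab(1) _ _ m weighted lower upper, of b] ab by force
  have series: "((\<lambda>n. (w n * cinner f (canonical_dual \<Gamma> \<psi> n)) *\<^sub>C \<psi> n) has_sum C f) \<Gamma>" for f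
  proof -
    define g where "g = inv (frame_operator \<Gamma> \<psi>) f"
    have "frame_operator \<Gamma> \<psi> g = f"
      unfolding g_def by (rule surj_f_inv_f[OF bij_is_surj[OF frame_operator_bij[OF fr]]])
    then have "((\<lambda>n. C (cinner g (\<psi> n) *\<^sub>C \<psi> n)) has_sum C f) \<Gamma>"
      using has_sum_bounded_linear[OF C(1) frame_operator_has_sum[OF fr, of g]] by simp
    moreover have "C (cinner g (\<psi> n) *\<^sub>C \<psi> n) =
        (w n * cinner f (canonical_dual \<Gamma> \<psi> n)) *\<^sub>C \<psi> n" if "n \<in> \<Gamma>" for n
      using that eig
      by (simp add: C(2) scaleC_scaleC cinner_canonical_dual[OF fr] g_def mult.commute)
    ultimately show ?thesis
      by (simp cong: has_sum_cong)
  qed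
  then have "C = frame_multiplier \<Gamma> w (canonical_dual \<Gamma> \<psi>) \<psi>"
    by (simp add: frame_multiplier_def fun_eq_iff infsumI[symmetric])
  ultimately show "semi_normalized {n\<in>\<Gamma>. \<psi> n \<noteq> 0} w \<and>
           positive_seq {n\<in>\<Gamma>. \<psi> n \<noteq> 0} w \<and>
           C = frame_multiplier \<Gamma> w (canonical_dual \<Gamma> \<psi>) \<psi> \<and>
           (\<forall>f. ((\<lambda>n. (w n * cinner f (canonical_dual \<Gamma> \<psi> n)) *\<^sub>C \<psi> n) has_sum C f) \<Gamma>)"
    using semi series by blast
qed

end
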